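(* Consider a point $\bar x\in\mathbb{R}^n$ along with a mapping $f:\mathbb{R}^n\to\mathbb{R}^m$ which is both defined and continuous in a vicinity of $\bar x$. Suppose that there is a surjective linear mapping $A:\mathbb{R}^n\to\mathbb{R}^m$ such that $\mathrm{calm}\,(f-A)(\bar x)<\mathrm{sur}\,A$. Denote by $\varSigma$ the set of all selections for $f^{-1}$ defined in a vicinity of $\bar y:=f(\bar x)$. Then $$\inf_{\sigma\in\varSigma}\mathrm{calm}\,\sigma(\bar y)\ \le\ \frac{1}{\mathrm{sur}\,A-\mathrm{calm}\,(f-A)(\bar x)}$$ and $$\inf_{\sigma\in\varSigma}\mathrm{calm}\,\big(\sigma-A^T(AA^T)^{-1}\big)(\bar y)\ \le\ \frac{\mathrm{calm}\,(f-A)(\bar x)}{\mathrm{sur}\,A\,\big(\mathrm{sur}\,A-\mathrm{calm}\,(f-A)(\bar x)\big)}.$$ In particular, if $f$ is Fréchet differentiable at $\bar x$, then there is $\sigma\in\varSigma$ which is Fréchet differentiable at $\bar y$ and $$\sigma'(\bar y)=[f'(\bar x)]^*\big(f'(\bar x)\,[f'(\bar x)]^*\big)^{-1}.$$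
   Context: $\mathbb{R}^n$, $\mathbb{R}^m$ carry Euclidean norms; linear mappings are identified with matrices in the canonical bases, $A^T$ is the transpose and $[f'(\bar x)]^*$ the adjoint (transpose). "In a vicinity of" a point means on some neighborhood of it. A selection for $f^{-1}$ defined in a vicinity of $\bar y$ is a single-valued mapping $\sigma$ from a neighborhood of $\bar y$ into $\mathbb{R}^n$ with $f(\sigma(y))=y$ for all $y$ in that neighborhood. For a mapping $g$ defined near a point $\bar u$, the calmness modulus $\mathrm{calm}\,g(\bar u)$ is the infimum of all $\mu>0$ for which there is a neighborhood $U\times V$ of $(\bar u,g(\bar u))$ such that $\|g(u)-g(\bar u)\|\le\mu\|u-\bar u\|$ whenever $u\in U$ and $g(u)\in V$ ($\inf\emptyset=\infty$). For a continuous linear operator $A$ the modulus of surjection is $\mathrm{sur}\,A=\sup\{\varrho>0: A(\mathbb{B}[0,1])\supset\mathbb{B}[0,\varrho]\}$, where $\mathbb{B}[0,r]$ is the closed ball; for a surjective matrix this is its least singular value. *)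

theory Defs
  imports "HOL-Analysis.Analysis"
begin

text \<open>Calmness modulus. It depends only on the germ of \<open>g\<close> at \<open>u0\<close>, because \<open>U\<close> may always be
  shrunk; so a mapping defined only near \<open>u0\<close> is represented by any total extension. The values lie
  in \<open>ennreal\<close>, where the infimum of the empty set is \<open>\<infinity>\<close>.\<close>

definition calm :: "('a::real_normed_vector \<Rightarrow> 'b::real_normed_vector) \<Rightarrow> 'a \<Rightarrow> ennreal" where
  "calm g u0 = Inf {ennreal \<mu> | \<mu>. \<mu> > 0 \<and>
     (\<exists>U V. open U \<and> u0 \<in> U \<and> open V \<and> g u0 \<in> V \<and>
        (\<forall>u\<in>U. g u \<in> V \<longrightarrow> norm (g u - g u0) \<le> \<mu> * norm (u - u0)))}"

definition sur :: "('a::real_normed_vector \<Rightarrow> 'b::real_normed_vector) \<Rightarrow> ennreal" where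
  "sur A = Sup {ennreal \<rho> | \<rho>. \<rho> > 0 \<and> cball 0 \<rho> \<subseteq> A ` cball 0 1}"

text \<open>Selections, defined in a vicinity of \<open>y0\<close>, for the inverse of a mapping \<open>f\<close> with domain \<open>D\<close>.
  The condition \<open>\<sigma> y \<in> D\<close> is needed because a HOL function \<open>f\<close> also has (meaningless) values
  outside \<open>D\<close>. The values of \<open>\<sigma>\<close> outside \<open>W\<close> are irrelevant.\<close>

definition selections :: "'a set \<Rightarrow> ('a \<Rightarrow> 'b::topological_space) \<Rightarrow> 'b \<Rightarrow> ('b \<Rightarrow> 'a) set" where
  "selections D f y0 = {\<sigma>. \<exists>W. open W \<and> y0 \<in> W \<and> (\<forall>y\<in>W. \<sigma> y \<in> D \<and> f (\<sigma> y) = y)}"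

end

theory Submission
  imports Defs
begin

text \<open>
  Write \<open>s\<close> for \<open>sur A\<close> and \<open>L\<close> for the right inverse \<open>A\<^sup>T (A A\<^sup>T)\<inverse>\<close>. Among all preimages of \<open>z\<close>
  under \<open>A\<close>, the vector \<open>L z\<close> has least norm, so \<open>norm (L z) \<le> norm z / s\<close>. Looking for a solution of
  \<open>f x = y\<close> of the form \<open>x = xbar + L z\<close> turns the equation into the fixed point problem
  \<open>z = w - h z\<close>, where \<open>w = y - f xbar\<close> and \<open>h z\<close> is the error made by \<open>A\<close> as an approximation of
  \<open>f\<close> between \<open>xbar\<close> and \<open>xbar + L z\<close>. If \<open>\<mu> < s\<close> is a calmness constant of \<open>f - A\<close>, then
  \<open>norm (h z) \<le> (\<mu> / s) * norm z\<close>, so the right-hand side maps the ball of radius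
  \<open>norm w / (1 - \<mu> / s)\<close> into itself, and it is continuous: Brouwer's theorem applies. Choosing a
  fixed point for each \<open>y\<close> gives a selection (\<open>calm_selection_exists\<close>) with
  \<open>norm (\<sigma> y - xbar) \<le> norm w / (s - \<mu>)\<close> and with the exact identity
  \<open>\<sigma> y - xbar - L w = - L (f (\<sigma> y) - f xbar - A (\<sigma> y - xbar))\<close>. The first bound is the first
  estimate, and inserting it into the identity is the second one, both with \<open>\<mu>\<close> in place of the
  calmness modulus; then \<open>\<mu>\<close> decreases to the modulus.

  If \<open>f\<close> has the derivative \<open>J\<close>, then \<open>J - A\<close> has operator norm less than \<open>s\<close>, so \<open>J\<close> is still surjective
  (\<open>surj_of_near_surj\<close>). The same construction with \<open>J\<close> as the approximating linear map and any
  sufficiently small fixed \<open>\<mu>\<close> yields a selection whose identity above has a right-hand side that is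
  \<open>o(norm (\<sigma> y - xbar))\<close>, hence \<open>o(norm w)\<close>: this one selection is differentiable.
\<close>

section \<open>The calmness modulus and local Lipschitz-type bounds\<close>

lemma calm_le:
  fixes g :: "'a::real_normed_vector \<Rightarrow> 'b::real_normed_vector"
  assumes "open U" "u0 \<in> U" "k > 0"
    and "\<And>u. u \<in> U \<Longrightarrow> norm (g u - g u0) \<le> k * norm (u - u0)"
  shows "calm g u0 \<le> ennreal k"
  unfolding calm_def
proof (rule Inf_lower, clarify, intro exI conjI)
  show "open (UNIV :: 'b set)" "g u0 \<in> UNIV" by auto
  show "\<forall>u\<in>U. g u \<in> UNIV \<longrightarrow> norm (g u - g u0) \<le> k * norm (u - u0)"
    using assms(4) by blast
qed (use assms in auto)

text \<open>Under continuity the requirement \<open>g u \<in> V\<close> in the calmness modulus is absorbed by shrinking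
  the neighborhood of the base point.\<close>

lemma calm_less_imp_local_bound:
  fixes g :: "'a::real_normed_vector \<Rightarrow> 'b::real_normed_vector"
  assumes "calm g u0 < ennreal \<mu>" "isCont g u0"
  obtains U where "open U" "u0 \<in> U" "\<And>u. u \<in> U \<Longrightarrow> norm (g u - g u0) \<le> \<mu> * norm (u - u0)"
proof -
  obtain \<nu> U V where \<nu>: "ennreal \<nu> < ennreal \<mu>" "\<nu> > 0" and UV: "open U" "u0 \<in> U" "open V" "g u0 \<in> V"
    and bd: "\<forall>u\<in>U. g u \<in> V \<longrightarrow> norm (g u - g u0) \<le> \<nu> * norm (u - u0)"
    using assms(1) unfolding calm_def Inf_less_iff by blast
  have "\<nu> \<le> \<mu>" using \<nu> by (simp add: ennreal_less_iff)
  obtain T where T: "open T" "u0 \<in> T" "\<forall>u\<in>T. g u \<in> V"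
    using assms(2) UV unfolding continuous_at_open by blast
  show thesis
  proof (rule that[of "U \<inter> T"])
    fix u assume "u \<in> U \<inter> T"
    then have "norm (g u - g u0) \<le> \<nu> * norm (u - u0)" using bd T by blast
    also have "\<dots> \<le> \<mu> * norm (u - u0)" using \<open>\<nu> \<le> \<mu>\<close> by (simp add: mult_right_mono)
    finally show "norm (g u - g u0) \<le> \<mu> * norm (u - u0)" .
  qed (use UV T in auto)
qed

section \<open>Selections from Brouwer's theorem\<close>

text \<open>With \<open>w = y - f x0\<close> and \<open>h z = f (x0 + L z) - f x0 - z\<close>, a solution \<open>x0 + L z\<close> of \<open>f x = y\<close> is a
  fixed point of \<open>z \<mapsto> w - h z\<close>. Since \<open>norm (h z) \<le> c * \<mu> * norm z\<close>, this is a self-map of the ball whose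
  radius \<open>r\<close> solves \<open>norm w + c * \<mu> * r = r\<close>; hence the constant \<open>c / (1 - c * \<mu>)\<close>. The last clause is
  the fixed point equation after applying \<open>L\<close>; it measures how far \<open>\<sigma>\<close> is from being affine.\<close>

lemma calm_selection_exists:
  fixes f :: "'a::real_normed_vector \<Rightarrow> 'b::euclidean_space"
  assumes U: "open U" "x0 \<in> U" "continuous_on U f"
    and A: "bounded_linear A" and L: "bounded_linear L"
    and AL: "\<And>z. A (L z) = z" and Lc: "\<And>z. norm (L z) \<le> c * norm z" and c: "c > 0"
    and bd: "\<And>x. x \<in> U \<Longrightarrow> norm (f x - f x0 - A (x - x0)) \<le> \<mu> * norm (x - x0)"
    and \<mu>: "\<mu> \<ge> 0" "c * \<mu> < 1"
  obtains W \<sigma> where "open W" "f x0 \<in> W"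
    "\<forall>y\<in>W. \<sigma> y \<in> U"
    "\<forall>y\<in>W. f (\<sigma> y) = y"
    "\<forall>y\<in>W. norm (\<sigma> y - x0) \<le> c / (1 - c * \<mu>) * norm (y - f x0)"
    "\<forall>y\<in>W. \<sigma> y - x0 - L (y - f x0) = - L (f (\<sigma> y) - f x0 - A (\<sigma> y - x0))"
proof -
  interpret A: bounded_linear A by fact
  interpret L: bounded_linear L by fact
  obtain d where d: "d > 0" "ball x0 d \<subseteq> U"
    using U open_contains_ball by blast
  define W where "W = ball (f x0) (d * (1 - c * \<mu>) / c)"
  define P where "P y x \<longleftrightarrow> x \<in> U \<and> f x = y \<and> norm (x - x0) \<le> c / (1 - c * \<mu>) * norm (y - f x0) \<and>
      x - x0 - L (y - f x0) = - L (f x - f x0 - A (x - x0))" for y x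
  have "\<exists>x. P y x" if "y \<in> W" for y
  proof -
    define w where "w = y - f x0"
    define r where "r = norm w / (1 - c * \<mu>)"
    have r0: "r \<ge> 0" using \<mu> by (simp add: r_def)
    have r_fix: "norm w + c * \<mu> * r = r"
      using \<mu> by (simp add: r_def field_simps)
    have "norm w < d * (1 - c * \<mu>) / c"
      using that by (simp add: W_def w_def dist_norm norm_minus_commute)
    then have cr: "c * r < d"
      using \<mu> c by (simp add: r_def field_simps)
    define h where "h z = f (x0 + L z) - f x0 - z" for z
    have near: "norm (L z) \<le> c * r" "x0 + L z \<in> U" if "z \<in> cball 0 r" for z
    proof -
      have "c * norm z \<le> c * r" using that c by simp
      then show n: "norm (L z) \<le> c * r" using Lc[of z] by linarith
      then have "x0 + L z \<in> ball x0 d" using cr by (simp add: dist_norm)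
      then show "x0 + L z \<in> U" using d by blast
    qed
    have h_le: "norm (h z) \<le> c * \<mu> * r" if "z \<in> cball 0 r" for z
    proof -
      have "norm (h z) \<le> \<mu> * norm (L z)"
        using bd[OF near(2)[OF that]] by (simp add: h_def AL)
      also have "\<dots> \<le> \<mu> * (c * r)"
        using near(1)[OF that] \<mu> by (simp add: mult_left_mono)
      finally show ?thesis by (simp add: mult_ac)
    qed
    have cont: "continuous_on (cball 0 r) (\<lambda>z. w - h z)"
    proof -
      have "continuous_on (cball 0 r) (\<lambda>z. f (x0 + L z))"
        by (rule continuous_on_compose2[OF U(3)])
          (use near in \<open>auto intro!: continuous_intros L.continuous_on\<close>)
      then show ?thesis unfolding h_def by (intro continuous_intros)
    qed
    have self: "(\<lambda>z. w - h z) \<in> cball 0 r \<rightarrow> cball 0 r"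
    proof
      fix z :: 'b assume "z \<in> cball 0 r"
      then have "norm (w - h z) \<le> norm w + c * \<mu> * r"
        using norm_triangle_ineq4[of w "h z"] h_le[of z] by linarith
      then show "w - h z \<in> cball 0 r" using r_fix by simp
    qed
    obtain z where z: "z \<in> cball 0 r" "w - h z = z"
      by (rule brouwer[OF compact_cball convex_cball _ cont self]) (use r0 in auto)
    have "P y (x0 + L z)"
      unfolding P_def
    proof (intro conjI)
      show "x0 + L z \<in> U" using near z by blast
      show "f (x0 + L z) = y" using z(2) by (simp add: h_def w_def algebra_simps)
      show "norm (x0 + L z - x0) \<le> c / (1 - c * \<mu>) * norm (y - f x0)"
        using near(1)[OF z(1)] by (simp add: r_def w_def)
      have "L z = L w - L (h z)" using z(2) L.diff by metis
      then show "x0 + L z - x0 - L (y - f x0) = - L (f (x0 + L z) - f x0 - A (x0 + L z - x0))"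
        by (simp add: AL h_def w_def algebra_simps)
    qed
    then show ?thesis ..
  qed
  then obtain \<sigma> where \<sigma>: "\<And>y. y \<in> W \<Longrightarrow> P y (\<sigma> y)" by metis
  show thesis
    by (rule that[of W \<sigma>]) (use \<sigma> d \<mu> c in \<open>auto simp: P_def W_def\<close>)
qed

text \<open>In \<open>calm_selection_exists\<close> with \<open>A\<close> the derivative of \<open>f\<close>, the deviation of \<open>\<sigma> y\<close> from
  \<open>x0 + L (y - f x0)\<close> is \<open>L\<close> applied to the first-order remainder of \<open>f\<close> at \<open>\<sigma> y\<close>. As \<open>\<sigma>\<close> is calm,
  this is \<open>o(norm (y - f x0))\<close>, although \<open>\<sigma>\<close> was built for one fixed \<open>\<mu>\<close> only.\<close>

lemma differentiable_selection_exists: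
  fixes f :: "'a::real_normed_vector \<Rightarrow> 'b::euclidean_space"
  assumes U: "open U" "x0 \<in> U" "continuous_on U f"
    and der: "(f has_derivative J) (at x0)"
    and L: "bounded_linear L" and JL: "\<And>z. J (L z) = z"
  obtains W \<sigma> where "open W" "f x0 \<in> W"
    "\<forall>y\<in>W. \<sigma> y \<in> U" "\<forall>y\<in>W. f (\<sigma> y) = y"
    "(\<sigma> has_derivative L) (at (f x0))"
proof -
  have J: "bounded_linear J"
    and alt: "\<And>e. e > 0 \<Longrightarrow> \<exists>d>0. \<forall>x. norm (x - x0) < d \<longrightarrow>
        norm (f x - f x0 - J (x - x0)) \<le> e * norm (x - x0)"
    using der unfolding has_derivative_at_alt by auto
  obtain c where c: "c > 0" "\<And>z. norm (L z) \<le> c * norm z"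
    using bounded_linear.pos_bounded[OF L] by (metis mult.commute)
  \<comment> \<open>Any \<open>\<mu> < 1 / c\<close> would do; this one makes \<open>\<sigma>\<close> calm with constant \<open>2 * c\<close>.\<close>
  define \<mu> where "\<mu> = 1 / (2 * c)"
  have \<mu>: "\<mu> > 0" "c * \<mu> = 1/2" using c by (auto simp: \<mu>_def)
  obtain d where d: "d > 0"
    "\<And>x. norm (x - x0) < d \<Longrightarrow> norm (f x - f x0 - J (x - x0)) \<le> \<mu> * norm (x - x0)"
    using alt[OF \<mu>(1)] by auto
  have openV: "open (U \<inter> ball x0 d)" and inV: "x0 \<in> U \<inter> ball x0 d"
    and contV: "continuous_on (U \<inter> ball x0 d) f"
    using U d by (auto intro: continuous_on_subset)
  have bd: "norm (f x - f x0 - J (x - x0)) \<le> \<mu> * norm (x - x0)" if "x \<in> U \<inter> ball x0 d" for x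
    using that d(2)[of x] by (simp add: dist_norm norm_minus_commute)
  have \<mu>': "\<mu> \<ge> 0" "c * \<mu> < 1" using \<mu> by auto
  obtain W \<sigma> where W: "open W" "f x0 \<in> W"
    and inU: "\<forall>y\<in>W. \<sigma> y \<in> U \<inter> ball x0 d"
    and sel: "\<forall>y\<in>W. f (\<sigma> y) = y"
    and lip0: "\<forall>y\<in>W. norm (\<sigma> y - x0) \<le> c / (1 - c * \<mu>) * norm (y - f x0)"
    and rem: "\<forall>y\<in>W. \<sigma> y - x0 - L (y - f x0) = - L (f (\<sigma> y) - f x0 - J (\<sigma> y - x0))"
    by (rule calm_selection_exists[OF openV inV contV J L JL c(2) c(1) bd \<mu>'])
  have lip: "norm (\<sigma> y - x0) \<le> 2 * c * norm (y - f x0)" if "y \<in> W" for y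
    using bspec[OF lip0 that] \<mu>(2) by simp
  have base: "\<sigma> (f x0) = x0" using lip[OF W(2)] by simp
  have "(\<sigma> has_derivative L) (at (f x0))"
    unfolding has_derivative_at_alt base
  proof (intro conjI allI impI L)
    fix e :: real assume e: "e > 0"
    \<comment> \<open>One factor \<open>c\<close> pays for \<open>norm (L _)\<close>, the other \<open>2 * c\<close> for \<open>norm (\<sigma> y - x0)\<close>.\<close>
    define e' where "e' = e / (2 * c * c)"
    have e': "e' > 0" using e c by (simp add: e'_def)
    obtain d' where d': "d' > 0"
      "\<And>x. norm (x - x0) < d' \<Longrightarrow> norm (f x - f x0 - J (x - x0)) \<le> e' * norm (x - x0)"
      using alt[OF e'] by auto
    obtain \<delta> where \<delta>: "\<delta> > 0" "ball (f x0) \<delta> \<subseteq> W"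
      using W open_contains_ball by blast
    show "\<exists>\<delta>>0. \<forall>y. norm (y - f x0) < \<delta> \<longrightarrow>
        norm (\<sigma> y - x0 - L (y - f x0)) \<le> e * norm (y - f x0)"
    proof (intro exI[of _ "min \<delta> (d' / (2 * c))"] conjI allI impI)
      show "0 < min \<delta> (d' / (2 * c))" using \<delta> d' c by simp
      fix y assume y: "norm (y - f x0) < min \<delta> (d' / (2 * c))"
      then have "y \<in> W" using \<delta> by (auto simp: dist_norm norm_minus_commute)
      have "2 * c * norm (y - f x0) < d'" using y c by (simp add: field_simps)
      then have small: "norm (\<sigma> y - x0) < d'" using lip[OF \<open>y \<in> W\<close>] by linarith
      have "norm (\<sigma> y - x0 - L (y - f x0)) \<le> c * norm (f (\<sigma> y) - f x0 - J (\<sigma> y - x0))"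
        using c(2) by (simp only: bspec[OF rem \<open>y \<in> W\<close>] norm_minus_cancel)
      also have "\<dots> \<le> c * (e' * norm (\<sigma> y - x0))"
        using d'(2)[OF small] c by simp
      also have "\<dots> \<le> c * (e' * (2 * c * norm (y - f x0)))"
        using lip[OF \<open>y \<in> W\<close>] c e' by simp
      also have "\<dots> = e * norm (y - f x0)" using c by (simp add: e'_def)
      finally show "norm (\<sigma> y - x0 - L (y - f x0)) \<le> e * norm (y - f x0)" .
    qed
  qed
  then show thesis using that[of W \<sigma>] W inU sel by blast
qed

section \<open>The right inverse of a surjective matrix and the modulus of surjection\<close>

text \<open>If \<open>A A\<^sup>T u = 0\<close>, then \<open>norm (A\<^sup>T u)\<^sup>2 = u \<bullet> A A\<^sup>T u = 0\<close>, so \<open>u\<close> is orthogonal to the range of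
  \<open>A\<close>; hence the Gram matrix of a surjective \<open>A\<close> is invertible.\<close>

lemma surj_matrix_right_inverse:
  fixes A :: "real^'n^'m"
  assumes "surj ((*v) A)"
  shows "A *v ((transpose A ** matrix_inv (A ** transpose A)) *v z) = z"
proof -
  have adj: "u \<bullet> (A *v x) = (transpose A *v u) \<bullet> x" for u x
    by (simp add: dot_lmul_matrix)
  have "u = 0" if "(A ** transpose A) *v u = 0" for u
  proof -
    have "(transpose A *v u) \<bullet> (transpose A *v u) = u \<bullet> ((A ** transpose A) *v u)"
      by (simp only: adj[symmetric] matrix_vector_mul_assoc)
    then have "transpose A *v u = 0" using that by simp
    then have "u \<bullet> (A *v x) = 0" for x by (simp only: adj inner_zero_left)
    moreover obtain x where "u = A *v x" using assms by blast
    ultimately show "u = 0" by (metis inner_eq_zero_iff)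
  qed
  then have "invertible (A ** transpose A)"
    unfolding invertible_left_inverse matrix_left_invertible_ker by blast
  then have "(A ** transpose A) ** matrix_inv (A ** transpose A) = mat 1"
    unfolding invertible_def matrix_inv_def by (rule someI_ex[THEN conjunct1])
  then show ?thesis
    by (simp add: matrix_vector_mul_assoc matrix_mul_assoc)
qed

text \<open>\<open>L z\<close> lies in the range of \<open>A\<^sup>T\<close>, so it is orthogonal to the kernel of \<open>A\<close> and therefore no
  longer than any other preimage \<open>x\<close> of \<open>z\<close>.\<close>

lemma right_inverse_minimal_norm:
  fixes A :: "real^'n^'m"
  assumes "surj ((*v) A)"
  shows "norm ((transpose A ** matrix_inv (A ** transpose A)) *v (A *v x)) \<le> norm x"
proof -
  define p where "p = (transpose A ** matrix_inv (A ** transpose A)) *v (A *v x)"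
  define u where "u = matrix_inv (A ** transpose A) *v (A *v x)"
  have adj: "u \<bullet> (A *v x) = (transpose A *v u) \<bullet> x" for u x
    by (simp add: dot_lmul_matrix)
  have p: "p = transpose A *v u" by (simp add: p_def u_def matrix_vector_mul_assoc matrix_mul_assoc)
  have "A *v p = A *v x" unfolding p_def by (rule surj_matrix_right_inverse[OF assms])
  then have "p \<bullet> p = p \<bullet> x" using adj[of u p] adj[of u x] p by metis
  then have "norm p * norm p \<le> norm p * norm x"
    using norm_cauchy_schwarz[of p x] by (simp flip: power2_norm_eq_inner add: power2_eq_square)
  then have "norm p \<le> norm x"
    by (cases "p = 0") auto
  then show ?thesis by (simp add: p_def)
qed

text \<open>For each \<open>\<rho>\<close> in the defining set of \<open>sur A\<close>, rescaling \<open>z\<close> to norm \<open>\<rho>\<close> gives it a preimage in the unit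
  ball. The product form keeps the statement meaningful while \<open>sur A\<close> is
  not yet known to be finite; finiteness then follows from it with any \<open>z \<noteq> 0\<close>.\<close>

lemma sur_mult_norm_right_inverse_le:
  fixes A :: "real^'n^'m"
  assumes "surj ((*v) A)"
  shows "sur ((*v) A) * ennreal (norm ((transpose A ** matrix_inv (A ** transpose A)) *v z))
    \<le> ennreal (norm z)"
proof -
  define L where "L = (\<lambda>z. (transpose A ** matrix_inv (A ** transpose A)) *v z)"
  have "\<rho> * norm (L z) \<le> norm z" if \<rho>: "\<rho> > 0" "cball 0 \<rho> \<subseteq> (*v) A ` cball 0 1" for \<rho>
  proof (cases "z = 0")
    case True
    then show ?thesis by (simp add: L_def)
  next
    case False
    have "(\<rho> / norm z) *\<^sub>R z \<in> cball (0 :: real^'m) \<rho>" using \<rho> False by simp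
    then obtain x where x: "norm x \<le> 1" "(\<rho> / norm z) *\<^sub>R z = A *v x"
      using \<rho>(2) by (metis (no_types, lifting) imageE mem_cball_0 subsetD)
    have "norm (L ((\<rho> / norm z) *\<^sub>R z)) \<le> 1"
      using right_inverse_minimal_norm[OF assms, of x] x by (simp add: L_def)
    then have "(\<rho> / norm z) * norm (L z) \<le> 1"
      using \<rho> by (simp add: L_def matrix_vector_mult_scaleR)
    then show ?thesis using False by (simp add: field_simps)
  qed
  then have "(SUP \<rho>\<in>{ennreal \<rho> | \<rho>. \<rho> > 0 \<and> cball 0 \<rho> \<subseteq> (*v) A ` cball 0 1}. \<rho> * ennreal (norm (L z)))
      \<le> ennreal (norm z)"
    by (intro SUP_least) (auto simp flip: ennreal_mult)
  then show ?thesis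
    unfolding sur_def L_def SUP_mult_right_ennreal[symmetric] by simp
qed

lemma sur_finite:
  fixes A :: "real^'n^'m"
  assumes "surj ((*v) A)"
  shows "sur ((*v) A) < top"
proof -
  define L where "L = (\<lambda>z. (transpose A ** matrix_inv (A ** transpose A)) *v z)"
  obtain z :: "real^'m" where "z \<noteq> 0" using UNIV_not_singleton[where 'a="real^'m"] by blast
  have "A *v (L z) = z" unfolding L_def by (rule surj_matrix_right_inverse[OF assms])
  then have "L z \<noteq> 0" using \<open>z \<noteq> 0\<close> by (metis matrix_vector_mult_0_right)
  then show ?thesis
    using sur_mult_norm_right_inverse_le[OF assms, of z]
    by (cases "sur ((*v) A)") (auto simp: L_def ennreal_top_mult top_unique)
qed

text \<open>With \<open>L\<close> a right inverse of \<open>A\<close>, the square map \<open>J \<circ> L = I + (J - A) \<circ> L\<close> is a perturbation of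
  the identity by less than \<open>1\<close>, hence injective and so surjective.\<close>

lemma surj_of_near_surj:
  fixes J A :: "'a::real_normed_vector \<Rightarrow> 'b::euclidean_space"
  assumes J: "linear J" and L: "linear L"
    and AL: "\<And>z. A (L z) = z" and Lc: "\<And>z. norm (L z) \<le> c * norm z"
    and near: "\<And>x. norm (J x - A x) \<le> \<mu> * norm x" and \<mu>: "\<mu> \<ge> 0" "c * \<mu> < 1"
  shows "surj J"
proof -
  have lin: "linear (J \<circ> L)" using L J by (rule linear_compose)
  have "z = 0" if "J (L z) = 0" for z
  proof (rule ccontr)
    assume "z \<noteq> 0"
    have "norm z \<le> \<mu> * norm (L z)" using near[of "L z"] that by (simp add: AL)
    also have "\<dots> \<le> \<mu> * (c * norm z)" using Lc \<mu> by (simp add: mult_left_mono)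
    also have "\<dots> = (c * \<mu>) * norm z" by simp
    also have "\<dots> < 1 * norm z" using \<mu>(2) \<open>z \<noteq> 0\<close> by (intro mult_strict_right_mono) auto
    finally show False by simp
  qed
  then have "inj (J \<circ> L)" using linear_injective_0[OF lin] by simp
  then have "surj (J \<circ> L)" using linear_injective_imp_surjective[OF lin] by blast
  then show "surj J" unfolding surj_def comp_apply by blast
qed

text \<open>Along the ray \<open>x0 + t *\<^sub>R v\<close> the derivative term is \<open>t * norm (G v)\<close> and the remainder is
  \<open>o(t)\<close>, so dividing the local bound by \<open>t\<close> leaves the bound on \<open>G v\<close>.\<close>

lemma norm_derivative_le_of_local_bound:
  fixes g :: "'a::real_normed_vector \<Rightarrow> 'b::real_normed_vector"
  assumes der: "(g has_derivative G) (at x0)" and U: "open U" "x0 \<in> U"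
    and bd: "\<And>x. x \<in> U \<Longrightarrow> norm (g x - g x0) \<le> \<mu> * norm (x - x0)"
  shows "norm (G v) \<le> \<mu> * norm v"
proof (rule field_le_epsilon)
  fix e :: real assume e: "e > 0"
  have lin: "bounded_linear G" using der has_derivative_bounded_linear by blast
  define k where "k = e / (norm v + 1)"
  have nv: "norm v + 1 > 0" by (simp add: add_nonneg_pos)
  have k: "k > 0" "k * norm v \<le> e" using e nv by (auto simp: k_def field_simps)
  obtain d where d: "d > 0"
    "\<And>x. norm (x - x0) < d \<Longrightarrow> norm (g x - g x0 - G (x - x0)) \<le> k * norm (x - x0)"
    using der k(1) unfolding has_derivative_at_alt by blast
  obtain \<delta> where \<delta>: "\<delta> > 0" "ball x0 \<delta> \<subseteq> U" using U open_contains_ball by blast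
  \<comment> \<open>The summand \<open>1\<close> covers \<open>v = 0\<close>.\<close>
  define t where "t = min d \<delta> / (2 * (norm v + 1))"
  have t: "t > 0" using d \<delta> nv by (simp add: t_def)
  have "t * norm v < t * (norm v + 1)" using t by simp
  also have "\<dots> = min d \<delta> / 2" using nv by (simp add: t_def field_simps)
  also have "\<dots> < min d \<delta>" using d \<delta> by linarith
  finally have small: "t * norm v < min d \<delta>" .
  define x where "x = x0 + t *\<^sub>R v"
  have x: "x - x0 = t *\<^sub>R v" "norm (x - x0) = t * norm v" using t by (auto simp: x_def)
  have "x \<in> U" using small \<delta> x(2) by (auto simp: dist_norm norm_minus_commute)
  have "t * norm (G v) = norm (G (x - x0))"
    using t by (simp add: x(1) linear_simps[OF lin])
  also have "\<dots> \<le> norm (g x - g x0) + norm (g x - g x0 - G (x - x0))"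
    using norm_triangle_sub[of "G (x - x0)" "g x - g x0"] by (simp add: norm_minus_commute)
  also have "\<dots> \<le> \<mu> * (t * norm v) + k * (t * norm v)"
    using bd[OF \<open>x \<in> U\<close>] d(2)[of x] small x(2) by simp
  finally have "t * norm (G v) \<le> t * (\<mu> * norm v + k * norm v)" by (simp add: algebra_simps)
  then have "norm (G v) \<le> \<mu> * norm v + k * norm v" using t by simp
  then show "norm (G v) \<le> \<mu> * norm v + e" using k by linarith
qed

section \<open>Calmness of selections\<close>

text \<open>The calmness modulus \<open>c\<close> is an infimum that may not be attained, so the estimates are available
  only for constants \<open>\<mu> > c\<close> and are passed to the limit.\<close>

lemma ennreal_le_of_right_limit:
  fixes \<phi> :: "real \<Rightarrow> real"
  assumes "c < s" "isCont \<phi> c" "\<And>\<mu>. c < \<mu> \<Longrightarrow> \<mu> < s \<Longrightarrow> a \<le> ennreal (\<phi> \<mu>)"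
  shows "a \<le> ennreal (\<phi> c)"
proof (rule tendsto_lowerbound)
  have "(\<phi> \<longlongrightarrow> \<phi> c) (at_right c)"
    using assms(2) filterlim_at_split isCont_def by blast
  then show "((\<lambda>\<mu>. ennreal (\<phi> \<mu>)) \<longlongrightarrow> ennreal (\<phi> c)) (at_right c)"
    by (rule tendsto_ennrealI)
  show "\<forall>\<^sub>F \<mu> in at_right c. a \<le> ennreal (\<phi> \<mu>)"
    using assms(1,3) eventually_at_right by blast
qed simp

theorem theorem3p6:
  fixes f :: "real^'n \<Rightarrow> real^'m" and D :: "(real^'n) set"
    and xbar :: "real^'n" and A :: "real^'n^'m"
  assumes "\<exists>U. open U \<and> xbar \<in> U \<and> U \<subseteq> D \<and> continuous_on U f"
    and "surj ((*v) A)"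
    and "calm (\<lambda>x. f x - A *v x) xbar < sur ((*v) A)"
  shows "(INF \<sigma>\<in>selections D f (f xbar). calm \<sigma> (f xbar))
           \<le> 1 / (sur ((*v) A) - calm (\<lambda>x. f x - A *v x) xbar)
    \<and> (INF \<sigma>\<in>selections D f (f xbar).
           calm (\<lambda>y. \<sigma> y - (transpose A ** matrix_inv (A ** transpose A)) *v y) (f xbar))
           \<le> calm (\<lambda>x. f x - A *v x) xbar
               / (sur ((*v) A) * (sur ((*v) A) - calm (\<lambda>x. f x - A *v x) xbar))
    \<and> (\<forall>J :: real^'n^'m. (f has_derivative (*v) J) (at xbar) \<longrightarrow>
         (\<exists>\<sigma>\<in>selections D f (f xbar).
            (\<sigma> has_derivative (*v) (transpose J ** matrix_inv (J ** transpose J))) (at (f xbar))))"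
proof -
  define g where "g = (\<lambda>x. f x - A *v x)"
  define B where "B = transpose A ** matrix_inv (A ** transpose A)"
  obtain U where U: "open U" "xbar \<in> U" "U \<subseteq> D" "continuous_on U f" using assms(1) by blast
  have gcont: "isCont g xbar"
    unfolding g_def using U continuous_on_eq_continuous_at
    by (intro continuous_intros) (auto intro: linear_continuous_at)
  have "calm g xbar < top" using assms(3) sur_finite[OF assms(2)] unfolding g_def by (rule less_trans)
  then obtain c where c: "c \<ge> 0" "calm g xbar = ennreal c"
    by (cases "calm g xbar") auto
  obtain s where s0: "s \<ge> 0" and s: "sur ((*v) A) = ennreal s"
    using sur_finite[OF assms(2)] by (cases "sur ((*v) A)") auto
  have "c < s" using assms(3) c s s0 unfolding g_def[symmetric] by (simp add: ennreal_less_iff)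
  then have spos: "s > 0" using c by simp
  have AB: "A *v (B *v z) = z" for z
    unfolding B_def by (rule surj_matrix_right_inverse[OF assms(2)])
  have Bs: "norm (B *v z) \<le> 1 / s * norm z" for z
  proof -
    have "ennreal (s * norm (B *v z)) \<le> ennreal (norm z)"
      using sur_mult_norm_right_inverse_le[OF assms(2), of z] s0
      by (simp add: B_def s ennreal_mult)
    then have "s * norm (B *v z) \<le> norm z" by simp
    then show ?thesis using spos by (simp add: field_simps)
  qed
  have local_bound: "\<exists>V. open V \<and> xbar \<in> V \<and> V \<subseteq> U \<and>
      (\<forall>x\<in>V. norm (g x - g xbar) \<le> \<mu> * norm (x - xbar))" if "c < \<mu>" for \<mu>
  proof -
    have "calm g xbar < ennreal \<mu>" using that c by (simp add: ennreal_less_iff)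
    then obtain T where "open T" "xbar \<in> T" "\<And>x. x \<in> T \<Longrightarrow> norm (g x - g xbar) \<le> \<mu> * norm (x - xbar)"
      using calm_less_imp_local_bound[OF _ gcont] by blast
    then show ?thesis using U by (intro exI[of _ "U \<inter> T"]) auto
  qed

  have estimates: "(INF \<sigma>\<in>selections D f (f xbar). calm \<sigma> (f xbar)) \<le> ennreal (1 / (s - \<mu>)) \<and>
      (INF \<sigma>\<in>selections D f (f xbar). calm (\<lambda>y. \<sigma> y - B *v y) (f xbar)) \<le> ennreal (\<mu> / (s * (s - \<mu>)))"
    if \<mu>: "c < \<mu>" "\<mu> < s" for \<mu>
  proof -
    obtain V where V: "open V" "xbar \<in> V" "V \<subseteq> U"
      and Vg: "\<And>x. x \<in> V \<Longrightarrow> norm (g x - g xbar) \<le> \<mu> * norm (x - xbar)"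
      using local_bound[OF \<mu>(1)] by blast
    have Vbd: "norm (f x - f xbar - A *v (x - xbar)) \<le> \<mu> * norm (x - xbar)" if "x \<in> V" for x
      using Vg[OF that] by (simp add: g_def matrix_vector_mult_diff_distrib algebra_simps)
    have contV: "continuous_on V f" using U V continuous_on_subset by blast
    have pos: "1 / s > 0" "\<mu> \<ge> 0" "1 / s * \<mu> < 1" using spos \<mu> c by auto
    have const: "1 / s / (1 - 1 / s * \<mu>) = 1 / (s - \<mu>)" using spos \<mu> by (simp add: field_simps)
    obtain W \<sigma> where W: "open W" "f xbar \<in> W"
      and inV: "\<forall>y\<in>W. \<sigma> y \<in> V" and sel: "\<forall>y\<in>W. f (\<sigma> y) = y"
      and lip: "\<forall>y\<in>W. norm (\<sigma> y - xbar) \<le> 1 / (s - \<mu>) * norm (y - f xbar)"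
      and rem: "\<forall>y\<in>W. \<sigma> y - xbar - B *v (y - f xbar) =
          - (B *v (f (\<sigma> y) - f xbar - A *v (\<sigma> y - xbar)))"
      by (rule calm_selection_exists[where A = "(*v) A" and L = "(*v) B" and c = "1 / s",
            OF V(1,2) contV matrix_vector_mul_bounded_linear matrix_vector_mul_bounded_linear
              AB Bs pos(1) Vbd pos(2,3), unfolded const])
    have base: "\<sigma> (f xbar) = xbar" using bspec[OF lip W(2)] by simp
    have \<sigma>: "\<sigma> \<in> selections D f (f xbar)"
      unfolding selections_def using W inV sel V U by blast
    have "calm \<sigma> (f xbar) \<le> ennreal (1 / (s - \<mu>))"
      by (rule calm_le[OF W]) (use lip \<mu> in \<open>simp_all add: base\<close>)
    moreover have "calm (\<lambda>y. \<sigma> y - B *v y) (f xbar) \<le> ennreal (\<mu> / (s * (s - \<mu>)))"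
    proof (rule calm_le[OF W])
      show "0 < \<mu> / (s * (s - \<mu>))" using \<mu> c spos by simp
      fix y assume y: "y \<in> W"
      have "(\<sigma> y - B *v y) - (\<sigma> (f xbar) - B *v f xbar) = \<sigma> y - xbar - B *v (y - f xbar)"
        by (simp add: base matrix_vector_mult_diff_distrib)
      then have "norm ((\<sigma> y - B *v y) - (\<sigma> (f xbar) - B *v f xbar))
          \<le> 1 / s * norm (f (\<sigma> y) - f xbar - A *v (\<sigma> y - xbar))"
        using Bs by (simp only: bspec[OF rem y] norm_minus_cancel)
      also have "\<dots> \<le> 1 / s * (\<mu> * norm (\<sigma> y - xbar))"
        by (rule mult_left_mono[OF Vbd[OF bspec[OF inV y]]]) (use spos in simp)
      also have "\<dots> \<le> 1 / s * (\<mu> * (1 / (s - \<mu>) * norm (y - f xbar)))"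
        by (intro mult_left_mono bspec[OF lip y]) (use spos pos in simp_all)
      also have "\<dots> = \<mu> / (s * (s - \<mu>)) * norm (y - f xbar)" by simp
      finally show "norm ((\<sigma> y - B *v y) - (\<sigma> (f xbar) - B *v f xbar))
          \<le> \<mu> / (s * (s - \<mu>)) * norm (y - f xbar)" .
    qed
    ultimately show ?thesis by (intro conjI INF_lower2[OF \<sigma>])
  qed

  have "(INF \<sigma>\<in>selections D f (f xbar). calm \<sigma> (f xbar)) \<le> ennreal (1 / (s - c))"
    by (rule ennreal_le_of_right_limit[OF \<open>c < s\<close>])
      (use estimates \<open>c < s\<close> in \<open>auto intro!: continuous_intros\<close>)
  also have "\<dots> = 1 / (sur ((*v) A) - calm g xbar)"
    using divide_ennreal[of 1 "s - c"] \<open>c < s\<close> c by (simp add: s ennreal_minus)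
  finally have first: "(INF \<sigma>\<in>selections D f (f xbar). calm \<sigma> (f xbar))
      \<le> 1 / (sur ((*v) A) - calm g xbar)" .

  have "(INF \<sigma>\<in>selections D f (f xbar). calm (\<lambda>y. \<sigma> y - B *v y) (f xbar))
      \<le> ennreal (c / (s * (s - c)))"
    by (rule ennreal_le_of_right_limit[OF \<open>c < s\<close>])
      (use estimates \<open>c < s\<close> spos in \<open>auto intro!: continuous_intros\<close>)
  also have "\<dots> = calm g xbar / (sur ((*v) A) * (sur ((*v) A) - calm g xbar))"
    using divide_ennreal[of c "s * (s - c)"] \<open>c < s\<close> c spos by (simp add: s ennreal_minus ennreal_mult)
  finally have second: "(INF \<sigma>\<in>selections D f (f xbar). calm (\<lambda>y. \<sigma> y - B *v y) (f xbar))
      \<le> calm g xbar / (sur ((*v) A) * (sur ((*v) A) - calm g xbar))" .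

  have third: "\<exists>\<sigma>\<in>selections D f (f xbar).
      (\<sigma> has_derivative (*v) (transpose J ** matrix_inv (J ** transpose J))) (at (f xbar))"
    if J: "(f has_derivative (*v) J) (at xbar)" for J :: "real^'n^'m"
  proof -
    obtain \<mu> where \<mu>: "c < \<mu>" "\<mu> < s" using \<open>c < s\<close> dense by blast
    obtain V where V: "open V" "xbar \<in> V"
      "\<And>x. x \<in> V \<Longrightarrow> norm (g x - g xbar) \<le> \<mu> * norm (x - xbar)"
      using local_bound[OF \<mu>(1)] by blast
    have "(g has_derivative (\<lambda>v. J *v v - A *v v)) (at xbar)"
      unfolding g_def using J
      by (intro derivative_intros bounded_linear_imp_has_derivative matrix_vector_mul_bounded_linear)
    then have near: "norm (J *v v - A *v v) \<le> \<mu> * norm v" for v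
      using norm_derivative_le_of_local_bound V by blast
    have "surj ((*v) J)"
      by (rule surj_of_near_surj[OF matrix_vector_mul_linear matrix_vector_mul_linear AB Bs near])
        (use \<mu> c spos in auto)
    then have JL: "J *v ((transpose J ** matrix_inv (J ** transpose J)) *v z) = z" for z
      by (rule surj_matrix_right_inverse)
    obtain W \<sigma> where "open W" "f xbar \<in> W"
      "\<forall>y\<in>W. \<sigma> y \<in> U" "\<forall>y\<in>W. f (\<sigma> y) = y"
      "(\<sigma> has_derivative (*v) (transpose J ** matrix_inv (J ** transpose J))) (at (f xbar))"
      using differentiable_selection_exists[OF U(1,2,4) J matrix_vector_mul_bounded_linear JL] by blast
    then show ?thesis unfolding selections_def using U(3) by blast
  qed
  show ?thesis using first second third unfolding g_def B_def by blast
qed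

end
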